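(* Consider the transposition game on the domain $D=\{1,\dots,d\}$ with an initial sequence of $m$ distinct elements of $D$, with $n$ turns to be played ($n$ a positive integer), and with $d\ge m+n$. (1) If $d=m+n$, then White wins. (2) If $d>m+n+1$ and, in the initial sequence (that is, with respect to the set $S$ of its elements), - there is no pivot, then White wins; - there is exactly one pivot, then the first player wins; - there is more than one pivot, then Black wins.
   Context: Transposition game: given a domain $D\subset\mathbb{R}$, a finite sequence of $m$ distinct elements of $D$, and a positive integer $n$, with $|D|\ge m+n$. Two players alternate; at each turn the player to move appends to the sequence one element of $D$ not already in it. After $n$ turns the sequence has $m+n$ terms and the game ends. One player wants the parity of the final sequence to be even, the other wants it to be odd (which player has which goal is fixed before the game starts). The parity of a finite sequence of distinct reals is the parity (mod 2) of the number of transpositions needed to put it in order. Black is the player who plays the last turn, and White is the player who plays the second last turn; so if $n$ is odd Black is the first player, and if $n$ is even White is the first player. "A player wins" means that this player has a winning strategy. $S$ denotes the set of elements already in the sequence; elements of $D\setminus S$ are called free. For $a,b\in S$, write $a\sim_S b$ if $[a,b]\cap D\subset S$, where $[a,b]$ is the closed interval with endpoints $a$ and $b$; this is an equivalence relation and its classes are the $S$-blocks. A pivot is an $S$-block with an odd number of elements such that there exist two free elements, one of which is smaller and the other larger than the elements of the block.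
   Formalization: The claims "White wins" (part 1, and part 2 with no pivot) are stated for n ≥ 2: for n = 1 there is no second last turn, and with d = 1, m = 0, n = 1 the final sequence (1) is even, so the player of the only turn (Black) wins if he wants even. *)

theory Defs
  imports "HOL-Combinatorics.Permutations"
begin

text \<open>A finite sequence is a list. The library's \<open>evenperm p\<close> says that \<open>p\<close> is a product of an
  even number of transpositions; for a list of distinct elements the permutation \<open>p\<close> of the
  positions that sorts the list is unique.\<close>

definition even_seq :: "'a::linorder list \<Rightarrow> bool" where
  "even_seq xs \<longleftrightarrow>
     (\<exists>p. p permutes {..<length xs} \<and> permute_list p xs = sort xs \<and> evenperm p)"

datatype player = Black | White

text \<open>Turns are numbered \<open>0, \<dots>, n - 1\<close>. Black plays the last turn and White the second last one;
  if \<open>n = 1\<close> there is no second last turn, so that White has no move.\<close>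

definition mover :: "nat \<Rightarrow> nat \<Rightarrow> player" where
  "mover n i = (if odd (n - i) then Black else White)"

definition first_player :: "nat \<Rightarrow> player" where
  "first_player n = mover n 0"

definition legal_moves :: "'a set \<Rightarrow> 'a list \<Rightarrow> 'a list \<Rightarrow> bool" where
  "legal_moves D xs ys \<longleftrightarrow> distinct ys \<and> set ys \<subseteq> D - set xs"

text \<open>A strategy maps the current sequence, which records all moves made so far, to the element to
  be appended. It has to prescribe a free element at each position in which it is \<open>P\<close>'s turn;
  otherwise \<open>wins\<close> below could hold vacuously.\<close>

definition strategy :: "'a set \<Rightarrow> 'a list \<Rightarrow> nat \<Rightarrow> player \<Rightarrow> ('a list \<Rightarrow> 'a) \<Rightarrow> bool" where
  "strategy D xs n P \<sigma> \<longleftrightarrow>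
     (\<forall>ys. legal_moves D xs ys \<and> length ys < n \<and> mover n (length ys) = P \<longrightarrow>
        \<sigma> (xs @ ys) \<in> D - set (xs @ ys))"

definition follows :: "'a list \<Rightarrow> nat \<Rightarrow> player \<Rightarrow> ('a list \<Rightarrow> 'a) \<Rightarrow> 'a list \<Rightarrow> bool" where
  "follows xs n P \<sigma> ys \<longleftrightarrow>
     (\<forall>i<n. mover n i = P \<longrightarrow> ys ! i = \<sigma> (xs @ take i ys))"

text \<open>The player \<open>E\<close> wants the final sequence to be even, the other player wants it to be odd.\<close>

definition goal :: "player \<Rightarrow> player \<Rightarrow> 'a::linorder list \<Rightarrow> bool" where
  "goal E P zs \<longleftrightarrow> (if P = E then even_seq zs else \<not> even_seq zs)"

definition wins :: "'a::linorder set \<Rightarrow> 'a list \<Rightarrow> nat \<Rightarrow> player \<Rightarrow> player \<Rightarrow> bool" where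
  "wins D xs n E P \<longleftrightarrow>
     (\<exists>\<sigma>. strategy D xs n P \<sigma> \<and>
        (\<forall>ys. legal_moves D xs ys \<and> length ys = n \<and> follows xs n P \<sigma> ys \<longrightarrow>
           goal E P (xs @ ys)))"

definition block_rel :: "'a::linorder set \<Rightarrow> 'a set \<Rightarrow> ('a \<times> 'a) set" where
  "block_rel D S = {(a, b). a \<in> S \<and> b \<in> S \<and> {min a b..max a b} \<inter> D \<subseteq> S}"

definition blocks :: "'a::linorder set \<Rightarrow> 'a set \<Rightarrow> 'a set set" where
  "blocks D S = S // block_rel D S"

definition pivots :: "'a::linorder set \<Rightarrow> 'a set \<Rightarrow> 'a set set" where
  "pivots D S =
     {B \<in> blocks D S. odd (card B) \<and>
        (\<exists>x \<in> D - S. \<exists>y \<in> D - S. \<forall>b \<in> B. x < b \<and> b < y)}"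

end

theory Submission
  imports Defs
begin

text \<open>Between two consecutive free elements \<open>a < b\<close> all elements are taken, so pivots correspond to
  adjacent equal letters in the word of parities of the increasingly ordered free elements. A turn
  deletes a letter, which changes the number \<open>k\<close> of such repetitions by at most one, and two
  consecutive free elements affect the parity of the sequence differently iff they form a
  repetition. Hence Black can choose the parity with the last turn iff \<open>k \<ge> 1\<close>. White, two turns
  before the end, wins if \<open>k \<le> 1\<close>: there are two free elements whose removal leaves no
  repetition, and playing them in either order gives opposite parities. If all of \<open>D\<close> gets
  played, only two elements are free at that stage and \<open>k \<le> 1\<close> holds automatically. For the
  earlier turns, White keeps \<open>k = 0\<close> after each of his moves, while Black can keep \<open>k \<ge> 2\<close>
  after each of his because a word of length at least 5 with a repetition has a letter whose
  deletion leaves at least two.\<close>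

section \<open>Parity of sequences\<close>

text \<open>As the terms are distinct, only one permutation sorts the list, so any sorter decides
  \<open>even_seq\<close>. If \<open>q\<close> sorts \<open>permute_list p xs\<close>, then
  \<open>p \<circ> q\<close> sorts \<open>xs\<close>, and signs multiply.\<close>

lemma even_seq_permute_list:
  assumes "distinct xs" "p permutes {..<length xs}"
  shows "even_seq (permute_list p xs) \<longleftrightarrow> (even_seq xs \<longleftrightarrow> evenperm p)"
proof -
  have sorter: "even_seq ys \<longleftrightarrow> evenperm q"
    if ys: "distinct ys" and q: "q permutes {..<length ys}" "permute_list q ys = sort ys" for q and ys :: "'a list"
  proof -
    have "r = q" if r: "r permutes {..<length ys}" "permute_list r ys = sort ys" for r
    proof
      fix i
      show "r i = q i"
      proof (cases "i < length ys")
        case True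
        then have "ys ! r i = ys ! q i"
          using r q permute_list_nth by metis
        moreover have "r i < length ys" "q i < length ys"
          using True permutes_in_image[OF r(1)] permutes_in_image[OF q(1)] by auto
        ultimately show ?thesis
          using ys by (simp add: nth_eq_iff_index_eq)
      next
        case False
        then show ?thesis
          using r(1) q(1) by (simp add: permutes_not_in)
      qed
    qed
    then show ?thesis
      unfolding even_seq_def using q by metis
  qed
  let ?ys = "permute_list p xs"
  have mset: "mset ?ys = mset xs"
    using assms(2) by simp
  then have dist: "distinct ?ys"
    using assms(1) mset_eq_imp_distinct_iff by blast
  have "mset (sort ?ys) = mset ?ys" by simp
  then obtain q where q: "q permutes {..<length ?ys}" "permute_list q ?ys = sort ?ys"
    using mset_eq_permutation by metis
  have "permute_list (p \<circ> q) xs = sort xs"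
    using q mset assms(2) by (simp add: permute_list_compose properties_for_sort)
  moreover have "p \<circ> q permutes {..<length xs}"
    using assms(2) q(1) by (simp add: permutes_compose)
  ultimately have "even_seq xs \<longleftrightarrow> evenperm (p \<circ> q)"
    using sorter assms(1) by blast
  moreover have "evenperm (p \<circ> q) \<longleftrightarrow> (evenperm p \<longleftrightarrow> evenperm q)"
    using assms(2) q(1) by (metis evenperm_comp permutation_permutes finite_lessThan)
  moreover have "even_seq ?ys \<longleftrightarrow> evenperm q"
    using sorter[OF dist] q by simp
  ultimately show ?thesis by blast
qed

lemma even_seq_swap:
  assumes "distinct (us @ x # y # vs)"
  shows "even_seq (us @ y # x # vs) \<longleftrightarrow> \<not> even_seq (us @ x # y # vs)"
proof -
  let ?p = "transpose (length us) (Suc (length us))"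
  have "permute_list ?p (us @ x # y # vs) = us @ y # x # vs"
  proof (rule nth_equalityI)
    fix i
    assume "i < length (permute_list ?p (us @ x # y # vs))"
    then have "permute_list ?p (us @ x # y # vs) ! i = (us @ x # y # vs) ! ?p i"
      by (simp add: permute_list_def del: upt_Suc)
    moreover consider "i < length us" | "i = length us" | "i = Suc (length us)"
      | j where "i = length us + Suc (Suc j)"
      by (metis add_Suc_right less_imp_Suc_add not_less_less_Suc_eq linorder_neqE_nat add_Suc_shift)
    then have "(us @ x # y # vs) ! ?p i = (us @ y # x # vs) ! i"
      by cases (auto simp: nth_append transpose_def)
    ultimately show "permute_list ?p (us @ x # y # vs) ! i = (us @ y # x # vs) ! i"
      by simp
  qed simp
  moreover have "?p permutes {..<length (us @ x # y # vs)}"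
    by (rule permutes_swap_id) auto
  moreover have "\<not> evenperm ?p"
    by (simp add: evenperm_swap)
  ultimately show ?thesis
    using even_seq_permute_list[OF assms, of ?p] by simp
qed

text \<open>\<open>x\<close> passes the terms of \<open>vs\<close> one by one, each time by an
  adjacent swap.\<close>

lemma even_seq_move_to_end:
  assumes "distinct (us @ x # vs)"
  shows "even_seq (us @ vs @ [x]) \<longleftrightarrow> (even_seq (us @ x # vs) \<longleftrightarrow> even (length vs))"
  using assms
proof (induction vs arbitrary: us)
  case (Cons v vs)
  have "even_seq ((us @ [v]) @ vs @ [x]) \<longleftrightarrow>
      (even_seq ((us @ [v]) @ x # vs) \<longleftrightarrow> even (length vs))"
    using Cons.prems by (intro Cons.IH) auto
  then show ?case
    using even_seq_swap[OF Cons.prems] by auto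
qed simp

lemma even_seq_sorted: "sorted xs \<Longrightarrow> even_seq xs"
  unfolding even_seq_def by (intro exI[of _ id]) (simp add: permutes_id sorted_sort_id evenperm_id)

text \<open>A permutation sorting \<open>xs\<close> fixes the additional last position, so it turns
  \<open>xs @ [x]\<close> into \<open>sort xs @ [x]\<close>; it remains to carry \<open>x\<close>
  past the larger terms.\<close>

lemma even_seq_snoc:
  assumes "distinct xs" "x \<notin> set xs"
  shows "even_seq (xs @ [x]) \<longleftrightarrow> (even_seq xs \<longleftrightarrow> even (card {s \<in> set xs. x < s}))"
proof -
  let ?lo = "filter (\<lambda>s. s < x) (sort xs)" and ?hi = "filter (\<lambda>s. x < s) (sort xs)"
  have split: "sort xs = ?lo @ ?hi"
  proof -
    have "sorted (?lo @ ?hi)"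
      by (auto simp: sorted_append intro: sorted_wrt_filter)
    moreover have "mset (?lo @ ?hi) = mset xs"
    proof -
      have "filter_mset (\<lambda>s. x < s) (mset xs) = filter_mset (\<lambda>s. \<not> s < x) (mset xs)"
        using assms(2) by (intro filter_mset_cong refl) (metis linorder_neqE order.asym set_mset_mset)
      then show ?thesis
        by simp
    qed
    ultimately show ?thesis
      by (metis properties_for_sort)
  qed
  obtain p where p: "p permutes {..<length xs}" "permute_list p xs = sort xs"
    using mset_eq_permutation mset_sort by metis
  have "permute_list p (xs @ [x]) = sort xs @ [x]"
  proof -
    have "permute_list p (xs @ [x]) = permute_list p xs @ [x]"
      using p(1) permutes_in_image[OF p(1)]
      by (auto simp: permute_list_def nth_append permutes_not_in)
    then show ?thesis using p(2) by simp
  qed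
  moreover have "p permutes {..<length (xs @ [x])}"
    using p(1) by (rule permutes_subset) auto
  ultimately have "even_seq (sort xs @ [x]) \<longleftrightarrow> (even_seq (xs @ [x]) \<longleftrightarrow> evenperm p)"
    using even_seq_permute_list[of "xs @ [x]" p] assms by auto
  moreover have "even_seq xs \<longleftrightarrow> evenperm p"
    using even_seq_permute_list[OF assms(1) p(1)] p(2) even_seq_sorted[of "sort xs"] by auto
  moreover have "even_seq (sort xs @ [x]) \<longleftrightarrow> even (length ?hi)"
  proof -
    have "distinct (?lo @ x # ?hi)" "sorted (?lo @ x # ?hi)"
      using assms by (auto simp: sorted_append intro: sorted_wrt_filter)
    then show ?thesis
      using even_seq_move_to_end[of ?lo x ?hi] split even_seq_sorted by (metis append.assoc)
  qed
  moreover have "length ?hi = card {s \<in> set xs. x < s}"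
    using assms(1) distinct_card[of ?hi] by simp
  ultimately show ?thesis by auto
qed

section \<open>Solving the game by backward induction\<close>

text \<open>The backward induction value with \<open>n\<close> turns still to come. Since
  \<open>mover\<close> depends only on the number of turns left, position \<open>0\<close> of a game
  with \<open>Suc n\<close> turns names the right player at every stage.\<close>

fun forces :: "'a::linorder set \<Rightarrow> player \<Rightarrow> player \<Rightarrow> nat \<Rightarrow> 'a list \<Rightarrow> bool" where
  "forces D E P 0 zs \<longleftrightarrow> goal E P zs"
| "forces D E P (Suc n) zs \<longleftrightarrow>
     (if mover (Suc n) 0 = P then \<exists>x \<in> D - set zs. forces D E P n (zs @ [x])
      else \<forall>x \<in> D - set zs. forces D E P n (zs @ [x]))"

text \<open>The strategy plays a free element that preserves \<open>forces\<close> if one exists,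
  and any free element otherwise; along every play that follows it, \<open>forces\<close> is an
  invariant.\<close>

lemma forces_imp_wins:
  assumes "finite D" "n \<le> card (D - set xs)" "forces D E P n xs"
  shows "wins D xs n E P"
proof -
  \<comment> \<open>Once \<open>x\<close> is appended to \<open>zs\<close>,
    \<open>n - Suc (length zs - length xs)\<close> turns remain.\<close>
  define good where
    "good zs x \<longleftrightarrow> forces D E P (n - Suc (length zs - length xs)) (zs @ [x])" for zs x
  define \<sigma> where "\<sigma> zs = (if \<exists>x \<in> D - set zs. good zs x then SOME x. x \<in> D - set zs \<and> good zs x
     else SOME x. x \<in> D - set zs)" for zs
  have good: "\<sigma> zs \<in> D - set zs \<and> good zs (\<sigma> zs)" if "\<exists>x \<in> D - set zs. good zs x" for zs
    using that someI_ex[of "\<lambda>x. x \<in> D - set zs \<and> good zs x"] unfolding \<sigma>_def by auto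
  have free: "\<sigma> zs \<in> D - set zs" if "D - set zs \<noteq> {}" for zs
    using that good[of zs] someI_ex[of "\<lambda>x. x \<in> D - set zs"] unfolding \<sigma>_def by auto
  \<comment> \<open>Legality is required in lost positions too; the bound on \<open>n\<close>
    guarantees a free element there.\<close>
  have "strategy D xs n P \<sigma>"
    unfolding strategy_def
  proof (intro allI impI, elim conjE)
    fix ys
    assume "legal_moves D xs ys" "length ys < n"
    then have "card (set ys) < card (D - set xs)"
      using assms(2) card_length[of ys] by linarith
    then have "\<not> D - set xs \<subseteq> set ys"
      by (meson card_mono leD List.finite_set)
    then have "D - set (xs @ ys) \<noteq> {}"
      by auto
    then show "\<sigma> (xs @ ys) \<in> D - set (xs @ ys)"
      by (rule free)
  qed
  moreover have "goal E P (xs @ ys)"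
    if legal: "legal_moves D xs ys" and len: "length ys = n" and fol: "follows xs n P \<sigma> ys" for ys
  proof -
    have "forces D E P (n - i) (xs @ take i ys)" if "i \<le> n" for i
      using that
    proof (induction i)
      case 0
      then show ?case using assms(3) by simp
    next
      case (Suc i)
      let ?zs = "xs @ take i ys"
      have i: "i < n" using Suc.prems by simp
      have step: "xs @ take (Suc i) ys = ?zs @ [ys ! i]"
        using i len by (simp add: take_Suc_conv_app_nth)
      have n_i: "n - i = Suc (n - Suc i)"
        using i by simp
      have IH: "forces D E P (Suc (n - Suc i)) ?zs"
        using Suc i n_i by simp
      have mover: "mover (Suc (n - Suc i)) 0 = mover n i"
        using n_i by (simp add: mover_def)
      have good_iff: "good ?zs x \<longleftrightarrow> forces D E P (n - Suc i) (?zs @ [x])" for x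
        using i len by (simp add: good_def)
      show ?case
      proof (cases "mover n i = P")
        case True
        then have "ys ! i = \<sigma> ?zs"
          using fol i unfolding follows_def by blast
        moreover have "\<exists>x \<in> D - set ?zs. good ?zs x"
          unfolding good_iff using IH mover True by simp
        ultimately show ?thesis
          using good good_iff step by metis
      next
        case False
        have "ys ! i \<in> D - set xs"
          using legal i len nth_mem[of i ys] unfolding legal_moves_def by blast
        moreover have "ys ! i \<notin> set (take i ys)"
          using legal i len
          unfolding legal_moves_def by (auto simp: in_set_conv_nth nth_eq_iff_index_eq)
        ultimately have "ys ! i \<in> D - set ?zs" by simp
        then show ?thesis
          using IH mover False step by simp
      qed
    qed
    from this[of n] show ?thesis
      using len by simp
  qed
  ultimately show ?thesis
    unfolding wins_def by blast
qed

section \<open>Adjacent repetitions in words\<close>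

fun repeats :: "'a list \<Rightarrow> nat" where
  "repeats (x # y # zs) = of_bool (x = y) + repeats (y # zs)"
| "repeats _ = 0"

lemma repeats_append: "repeats (us @ x # vs) = repeats (us @ [x]) + repeats (x # vs)"
proof (induction us)
  case (Cons u us)
  then show ?case by (cases us) auto
qed simp

lemma repeats_Cons: "repeats (x # vs) = of_bool (vs \<noteq> [] \<and> x = hd vs) + repeats vs"
  by (cases vs) auto

lemma repeats_snoc: "repeats (us @ [x]) = repeats us + of_bool (us \<noteq> [] \<and> x = last us)"
proof (induction us)
  case (Cons u us)
  then show ?case by (cases us) auto
qed simp

text \<open>A deletion destroys two repetitions only if \<open>x\<close> equals both its neighbours,
  but then these become a new repetition.\<close>

lemma repeats_le_delete: "repeats (us @ x # vs) \<le> Suc (repeats (us @ vs))"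
proof (cases vs)
  case (Cons v vs')
  then show ?thesis
    by (auto simp: repeats_append[of us x "v # vs'"] repeats_append[of us v vs'] repeats_snoc)
qed (auto simp: repeats_snoc)

text \<open>A deletion creates at most one new adjacent pair.\<close>

lemma repeats_delete_le: "repeats (us @ vs) \<le> Suc (repeats (us @ x # vs))"
proof (cases vs)
  case (Cons v vs')
  then show ?thesis
    by (auto simp: repeats_append[of us x "v # vs'"] repeats_append[of us v vs'] repeats_snoc)
qed (auto simp: repeats_snoc)

lemma repeats_le_length: "repeats w \<le> length w - 1"
  by (induction w rule: repeats.induct) auto

lemma repeats_posD:
  assumes "repeats w > 0"
  obtains us u vs where "w = us @ u # u # vs"
  using assms
proof (induction w arbitrary: thesis rule: repeats.induct)
  case (1 x y zs)
  show ?case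
  proof (cases "x = y")
    case True
    then show ?thesis
      using "1.prems"(1)[of "[]"] by simp
  next
    case False
    then obtain us u vs where "y # zs = us @ u # u # vs"
      using "1.IH" "1.prems"(2) by auto
    then show ?thesis
      using "1.prems"(1)[of "x # us"] by simp
  qed
qed auto

text \<open>Merging the two letters of the only repetition keeps all other adjacencies.\<close>

lemma repeats_eq_1D:
  assumes "repeats w = 1"
  obtains us u vs where "w = us @ u # u # vs" "repeats (us @ u # vs) = 0"
  using assms
proof (induction w arbitrary: thesis rule: repeats.induct)
  case (1 x y zs)
  show ?case
  proof (cases "x = y")
    case True
    then show ?thesis
      using "1.prems"(1)[of "[]" x zs] "1.prems"(2) by simp
  next
    case False
    then obtain us u vs where *: "y # zs = us @ u # u # vs" "repeats (us @ u # vs) = 0"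
      using "1.IH" "1.prems"(2) by auto
    moreover from * have "hd (us @ u # vs) = y"
      by (cases us) auto
    ultimately show ?thesis
      using "1.prems"(1)[of "x # us" u vs] False by (simp add: repeats_Cons[of x])
  qed
qed auto

text \<open>A suitable letter is always among the first five, which a check of all cases confirms.
  Four letters are too few: every deletion from \<open>[False, True, True, False]\<close> leaves at
  most one repetition.\<close>

lemma exists_delete_repeats_ge_2:
  fixes w :: "bool list"
  assumes "length w \<ge> 5" "repeats w \<ge> 1"
  obtains us x vs where "w = us @ x # vs" "repeats (us @ vs) \<ge> 2"
proof -
  obtain a b c d e vs where w: "w = a # b # c # d # e # vs"
    using assms(1) by (auto simp: numeral_eq_Suc Suc_le_length_iff)
  have "repeats (b # c # d # e # vs) \<ge> 2 \<or> repeats (a # c # d # e # vs) \<ge> 2 \<or>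
    repeats (a # b # d # e # vs) \<ge> 2 \<or> repeats (a # b # c # e # vs) \<ge> 2 \<or>
    repeats (a # b # c # d # vs) \<ge> 2"
    using assms(2) unfolding w by (cases a; cases b; cases c; cases d; cases e; cases vs) auto
  then show thesis
    using that[of "[]" a "b # c # d # e # vs"] that[of "[a]" b "c # d # e # vs"]
      that[of "[a, b]" c "d # e # vs"] that[of "[a, b, c]" d "e # vs"]
      that[of "[a, b, c, d]" e vs] w by auto
qed

section \<open>The free elements\<close>

definition free_list :: "nat \<Rightarrow> nat list \<Rightarrow> nat list" where
  "free_list d zs = sorted_list_of_set ({1..d} - set zs)"

lemma set_free_list [simp]: "set (free_list d zs) = {1..d} - set zs"
  and distinct_free_list [simp]: "distinct (free_list d zs)"
  and sorted_free_list [simp]: "sorted_wrt (<) (free_list d zs)"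
  by (simp_all add: free_list_def strict_sorted_list_of_set)

lemma length_free_list:
  assumes "distinct zs" "set zs \<subseteq> {1..d}"
  shows "length (free_list d zs) = d - length zs"
  using assms by (simp add: free_list_def card_Diff_subset distinct_card)

lemma free_list_snoc:
  assumes "free_list d zs = us @ x # vs"
  shows "free_list d (zs @ [x]) = us @ vs"
proof -
  have "distinct (us @ x # vs)"
    by (simp flip: assms)
  moreover have "{1..d} - set (zs @ [x]) = {1..d} - set zs - {x}" by auto
  then have "free_list d (zs @ [x]) = remove1 x (free_list d zs)"
    unfolding free_list_def by (simp only: sorted_list_of_set_remove finite_Diff finite_atLeastAtMost)
  ultimately show ?thesis
    using assms by (simp add: remove1_append)
qed

lemma free_list_memD: "free_list d zs = us @ x # vs \<Longrightarrow> x \<in> {1..d} - set zs"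
  by (metis in_set_conv_decomp set_free_list)

text \<open>Of the \<open>d - x\<close> elements above \<open>x\<close>, exactly
  \<open>length vs\<close> are free, so the number of terms of \<open>zs\<close> above
  \<open>x\<close> has the parity of \<open>d + x + length vs\<close>.\<close>

lemma even_seq_move:
  assumes "distinct zs" "set zs \<subseteq> {1..d}" and fl: "free_list d zs = us @ x # vs"
  shows "even_seq (zs @ [x]) \<longleftrightarrow> (even_seq zs \<longleftrightarrow> even (d + x + length vs))"
proof -
  have x: "x \<in> {1..d} - set zs"
    by (rule free_list_memD[OF fl])
  then have "x \<le> d" by simp
  have sorted: "sorted_wrt (<) (us @ x # vs)" and free: "{1..d} - set zs = set (us @ x # vs)"
    by (simp_all flip: fl)
  have "set vs = {y \<in> {1..d} - set zs. x < y}"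
    unfolding free using sorted by (auto simp: sorted_wrt_append dest: order.asym)
  then have "{x<..d} = {s \<in> set zs. x < s} \<union> set vs" "{s \<in> set zs. x < s} \<inter> set vs = {}"
    using assms(2) by auto
  then have "d - x = card {s \<in> set zs. x < s} + card (set vs)"
    by (metis card_Un_disjoint card_greaterThanAtMost finite_set finite_Un finite_greaterThanAtMost)
  also have "card (set vs) = length vs"
    using sorted by (simp add: sorted_wrt_append distinct_card strict_sorted_iff)
  finally have "d = x + (card {s \<in> set zs. x < s} + length vs)"
    using \<open>x \<le> d\<close> le_add_diff_inverse by metis
  then have "even d \<longleftrightarrow> even (x + (card {s \<in> set zs. x < s} + length vs))"
    by (rule arg_cong)
  then have "even (d + x + length vs) \<longleftrightarrow> even (card {s \<in> set zs. x < s})"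
    unfolding even_add by blast
  then show ?thesis
    using even_seq_snoc[of zs x] assms(1) x by simp
qed

text \<open>One step along an alternating list flips the parity of the element and shortens the rest
  by one, so the parity of their sum is constant. At the head the rest is one shorter than the list,
  hence \<open>odd\<close> on the right.\<close>

lemma repeats_eq_0_parity:
  fixes us vs :: "nat list"
  assumes "repeats (map even (us @ x # vs)) = 0"
  shows "even (x + length vs) \<longleftrightarrow> odd (hd (us @ x # vs) + length (us @ x # vs))"
  using assms
proof (induction us)
  case (Cons u us)
  then show ?case
    by (cases us) auto
qed simp

lemma even_seq_indifferent:
  assumes "distinct zs" "set zs \<subseteq> {1..d}" "repeats (map even (free_list d zs)) = 0"
    and "x \<in> {1..d} - set zs" "y \<in> {1..d} - set zs"
  shows "even_seq (zs @ [x]) \<longleftrightarrow> even_seq (zs @ [y])"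
proof -
  let ?l = "free_list d zs"
  have parity: "even (z + length ws) \<longleftrightarrow> odd (hd ?l + length ?l)" if "?l = ws' @ z # ws" for z ws ws'
    using repeats_eq_0_parity[of ws' z ws] assms(3) by (simp only: that)
  obtain us vs us' vs' where x: "?l = us @ x # vs" and y: "?l = us' @ y # vs'"
    using assms(4,5) by (metis set_free_list split_list)
  have "even (x + length vs) \<longleftrightarrow> even (y + length vs')"
    using parity[OF x] parity[OF y] by blast
  then show ?thesis
    using even_seq_move[OF assms(1,2) x] even_seq_move[OF assms(1,2) y] by auto
qed

section \<open>Pivots\<close>

text \<open>For \<open>F\<close> the set of free elements, these are the pairs of consecutive free
  elements that enclose a pivot: \<open>b - a - 1\<close> is odd iff \<open>a + b\<close> is
  even.\<close>

definition even_gaps :: "nat set \<Rightarrow> (nat \<times> nat) set" where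
  "even_gaps F = {(a, b). a \<in> F \<and> b \<in> F \<and> a < b \<and> {a<..<b} \<inter> F = {} \<and> even (a + b)}"

lemma Suc_less_if_even_gaps: "(a, b) \<in> even_gaps F \<Longrightarrow> Suc a < b"
  by (cases "b = Suc a") (auto simp: even_gaps_def)

text \<open>A new least element \<open>a\<close> can form a gap only with its successor
  \<open>b\<close> and leaves the other gaps intact.\<close>

lemma card_even_gaps:
  assumes "sorted_wrt (<) ls"
  shows "finite (even_gaps (set ls)) \<and> card (even_gaps (set ls)) = repeats (map even ls)"
  using assms
proof (induction ls rule: repeats.induct)
  case (1 a b ls)
  let ?G = "even_gaps (set (b # ls))"
  have less: "a < b" "\<forall>c \<in> set ls. b < c"
    using "1.prems" by auto
  have "even_gaps (set (a # b # ls)) = (if even (a + b) then {(a, b)} else {}) \<union> ?G"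
    using less unfolding even_gaps_def by (auto dest: order.strict_trans order.asym)
  moreover have "(a, b) \<notin> ?G"
    using less by (auto simp: even_gaps_def)
  ultimately show ?case
    using "1.IH" "1.prems" by auto
next
  case ("2_2" v)
  have "even_gaps (set [v]) = {}"
    by (auto simp: even_gaps_def)
  then show ?case by simp
qed (simp add: even_gaps_def)

lemma block_eq_gap:
  fixes a b s d :: nat
  assumes "a \<in> {1..d} - S" "b \<in> {1..d} - S" "{a<..<b} \<inter> ({1..d} - S) = {}" "s \<in> {a<..<b}"
  shows "block_rel {1..d} S `` {s} = {a<..<b}"
proof (intro equalityI subsetI)
  fix t
  assume "t \<in> block_rel {1..d} S `` {s}"
  then have t: "{min s t..max s t} \<inter> {1..d} \<subseteq> S"
    by (simp add: block_rel_def)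
  have "a < t"
  proof (rule ccontr)
    assume "\<not> a < t"
    then have "a \<in> {min s t..max s t} \<inter> {1..d}"
      using assms(1,4) by auto
    then show False
      using t assms(1) by blast
  qed
  moreover have "t < b"
  proof (rule ccontr)
    assume "\<not> t < b"
    then have "b \<in> {min s t..max s t} \<inter> {1..d}"
      using assms(2,4) by auto
    then show False
      using t assms(2) by blast
  qed
  ultimately show "t \<in> {a<..<b}" by simp
next
  fix t
  assume t: "t \<in> {a<..<b}"
  then have "{min s t..max s t} \<subseteq> {a<..<b}"
    using assms(4) by auto
  moreover have "{a<..<b} \<subseteq> S"
    using assms(1-3) by auto
  ultimately show "t \<in> block_rel {1..d} S `` {s}"
    using t assms(4) by (auto simp: block_rel_def)
qed

text \<open>A block with free elements on both sides fills the whole interval between the nearest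
  ones.\<close>

lemma pivots_eq_gaps:
  assumes "S \<subseteq> {1..d}"
  shows "pivots {1..d} S = (\<lambda>(a, b). {a<..<b}) ` even_gaps ({1..d} - S)"
proof (intro equalityI subsetI)
  let ?F = "{1..d} - S"
  fix B
  assume "B \<in> pivots {1..d} S"
  then obtain s x y where s: "s \<in> S" "B = block_rel {1..d} S `` {s}" and B: "odd (card B)"
    and xy: "x \<in> ?F" "y \<in> ?F" "\<forall>b \<in> B. x < b \<and> b < y"
    unfolding pivots_def blocks_def by (auto elim!: quotientE)
  have "s \<in> B"
    using s by (auto simp: block_rel_def)
  then have ne: "{z \<in> ?F. z < s} \<noteq> {}" "{z \<in> ?F. s < z} \<noteq> {}"
    using xy by auto
  \<comment> \<open>The free elements nearest to \<open>s\<close> on either side; \<open>x\<close>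
    and \<open>y\<close> ensure that they exist.\<close>
  define a b where "a = Max {z \<in> ?F. z < s}" and "b = Min {z \<in> ?F. s < z}"
  have a: "a \<in> {z \<in> ?F. z < s}" and b: "b \<in> {z \<in> ?F. s < z}"
    unfolding a_def b_def using ne by (intro Max_in Min_in; simp)+
  have "{a<..<b} \<inter> ?F = {}"
  proof -
    have "z \<le> a" if "z \<in> ?F" "z < s" for z
      unfolding a_def using that by (intro Max_ge) auto
    moreover have "b \<le> z" if "z \<in> ?F" "s < z" for z
      unfolding b_def using that by (intro Min_le) auto
    ultimately show ?thesis
      using s(1) by (metis (no_types, lifting) DiffD2 Int_iff greaterThanLessThan_iff
          leD linorder_neqE_nat equals0I)
  qed
  moreover from this have "B = {a<..<b}"
    using block_eq_gap[of a d S b s] a b s(2) by auto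
  moreover from this have "even (a + b)"
    using B a b by (auto simp: card_greaterThanLessThan even_diff_nat)
  ultimately show "B \<in> (\<lambda>(a, b). {a<..<b}) ` even_gaps ?F"
    using a b by (auto simp: even_gaps_def intro!: image_eqI[of _ _ "(a, b)"])
next
  let ?F = "{1..d} - S"
  fix B
  assume "B \<in> (\<lambda>(a, b). {a<..<b}) ` even_gaps ?F"
  then obtain a b where B: "B = {a<..<b}" and ab: "a \<in> ?F" "b \<in> ?F" "a < b"
    "{a<..<b} \<inter> ?F = {}" "even (a + b)"
    by (auto simp: even_gaps_def)
  \<comment> \<open>Equal parity of \<open>a\<close> and \<open>b\<close> makes the gap nonempty, so
    that \<open>Suc a\<close> can represent its block.\<close>
  then have "Suc a \<noteq> b" by auto
  then have s: "Suc a \<in> {a<..<b}"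
    using ab(3) by auto
  then have "Suc a \<in> S"
    using ab by auto
  then have "B \<in> blocks {1..d} S"
    unfolding blocks_def B block_eq_gap[OF ab(1,2,4) s, symmetric] by (rule quotientI)
  moreover have "odd (card B)"
    using ab(3,5) by (auto simp: B card_greaterThanLessThan even_diff_nat)
  moreover have "\<forall>c \<in> B. a < c \<and> c < b"
    by (simp add: B)
  ultimately show "B \<in> pivots {1..d} S"
    using ab(1,2) unfolding pivots_def by blast
qed

lemma card_pivots:
  assumes "set zs \<subseteq> {1..d}"
  shows "card (pivots {1..d} (set zs)) = repeats (map even (free_list d zs))"
proof -
  let ?G = "even_gaps ({1..d} - set zs)"
  have card: "card ?G = repeats (map even (free_list d zs))"
    using card_even_gaps[of "free_list d zs"] by auto
  \<comment> \<open>Nonempty open intervals determine their endpoints; empty ones would not.\<close>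
  have "inj_on (\<lambda>(a, b). {a<..<b}) ?G"
  proof (rule inj_onI, clarify)
    fix a b a' b'
    assume "(a, b) \<in> ?G" "(a', b') \<in> ?G" and eq: "{a<..<b} = {a'<..<b'}"
    then have "Suc a < b" "Suc a' < b'"
      using Suc_less_if_even_gaps by blast+
    then show "a = a' \<and> b = b'"
      using eq by (auto simp flip: atLeastSucLessThan_greaterThanLessThan simp: atLeastLessThan_eq_iff)
  qed
  then show ?thesis
    unfolding pivots_eq_gaps[OF assms] using card by (simp add: card_image)
qed

section \<open>The winning strategies\<close>

lemma free_list_split:
  assumes "x \<in> {1..d} - set zs"
  obtains us vs where "free_list d zs = us @ x # vs" "free_list d (zs @ [x]) = us @ vs"
  using assms by (metis set_free_list split_list free_list_snoc)

lemma repeats_move: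
  assumes "x \<in> {1..d} - set zs"
  shows "repeats (map even (free_list d zs)) \<le> Suc (repeats (map even (free_list d (zs @ [x]))))"
    and "repeats (map even (free_list d (zs @ [x]))) \<le> Suc (repeats (map even (free_list d zs)))"
    and "length (free_list d zs) = Suc (length (free_list d (zs @ [x])))"
proof -
  obtain us vs where "free_list d zs = us @ x # vs" "free_list d (zs @ [x]) = us @ vs"
    using free_list_split[OF assms] .
  then show "repeats (map even (free_list d zs)) \<le> Suc (repeats (map even (free_list d (zs @ [x]))))"
    and "repeats (map even (free_list d (zs @ [x]))) \<le> Suc (repeats (map even (free_list d zs)))"
    and "length (free_list d zs) = Suc (length (free_list d (zs @ [x])))"
    by (simp_all add: repeats_le_delete repeats_delete_le)
qed

text \<open>If there is no repetition, the first and the last free element can be taken, since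
  deleting an end creates no adjacency. If there is one, its two members can be taken.\<close>

lemma two_moves_without_repeats:
  assumes "repeats (map even (free_list d zs)) \<le> 1" "length (free_list d zs) \<ge> 2"
  obtains a b where "a \<in> {1..d} - set zs" "b \<in> {1..d} - set zs" "a \<noteq> b"
    "repeats (map even (free_list d (zs @ [a]))) = 0"
    "repeats (map even (free_list d (zs @ [b]))) = 0"
proof (cases "repeats (map even (free_list d zs)) = 0")
  case True
  obtain a c cs where "free_list d zs = a # c # cs"
    using assms(2) by (auto simp: numeral_2_eq_2 Suc_le_length_iff)
  then obtain ms b where fl: "free_list d zs = a # ms @ [b]"
    by (metis rev_exhaust list.distinct(1))
  then have "a \<noteq> b"
    by (metis distinct_free_list distinct.simps(2) in_set_conv_decomp)
  moreover have "free_list d (zs @ [a]) = ms @ [b]" "free_list d (zs @ [b]) = a # ms"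
    using free_list_snoc[of d zs "[]" a "ms @ [b]"] free_list_snoc[of d zs "a # ms" b "[]"] fl
    by auto
  moreover have "repeats (map even (ms @ [b])) = 0" "repeats (map even (a # ms)) = 0"
  proof -
    have "repeats (map even (ms @ [b])) \<le> repeats (even a # map even (ms @ [b]))"
      by (simp only: repeats_Cons le_add2)
    moreover have "repeats (map even (a # ms)) \<le> repeats (map even (a # ms) @ [even b])"
      by (simp only: repeats_snoc le_add1)
    ultimately show "repeats (map even (ms @ [b])) = 0" "repeats (map even (a # ms)) = 0"
      using True by (simp_all add: fl)
  qed
  ultimately show ?thesis
    using that fl free_list_memD[of d zs "[]" a] free_list_memD[of d zs "a # ms" b] by auto
next
  case False
  then have "repeats (map even (free_list d zs)) = 1"
    using assms(1) by simp
  then obtain us u vs where "map even (free_list d zs) = us @ u # u # vs"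
    and 0: "repeats (us @ u # vs) = 0"
    by (rule repeats_eq_1D)
  then obtain us' a b vs' where fl: "free_list d zs = us' @ a # b # vs'"
    and "map even us' = us" "even a = u" "even b = u" "map even vs' = vs"
    by (auto simp: map_eq_append_conv map_eq_Cons_conv)
  moreover have "a \<noteq> b"
    using distinct_free_list[of d zs] unfolding fl by auto
  moreover have "free_list d (zs @ [a]) = us' @ b # vs'" "free_list d (zs @ [b]) = us' @ a # vs'"
    using free_list_snoc[of d zs us' a] free_list_snoc[of d zs "us' @ [a]" b] fl by auto
  ultimately show ?thesis
    using that 0 free_list_memD[of d zs us' a] free_list_memD[of d zs "us' @ [a]" b] by auto
qed

lemma mover_Suc_0: "mover (Suc n) 0 = (if even n then Black else White)"
  by (simp add: mover_def)

lemma goal_cases: "goal E P xs \<or> goal E P ys" if "even_seq xs \<noteq> even_seq ys"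
  using that by (auto simp: goal_def)

lemma goal_cong: "even_seq xs = even_seq ys \<Longrightarrow> goal E P xs = goal E P ys"
  by (auto simp: goal_def)

text \<open>Without repetitions Black's last move is immaterial, so after \<open>a\<close> it may be taken to be
  \<open>b\<close> and vice versa; the two resulting sequences differ by one transposition.\<close>

lemma forces_White_2:
  assumes "distinct zs" "set zs \<subseteq> {1..d}"
    and "repeats (map even (free_list d zs)) \<le> 1" "length (free_list d zs) \<ge> 2"
  shows "forces {1..d} E White 2 zs"
proof -
  obtain a b where ab: "a \<in> {1..d} - set zs" "b \<in> {1..d} - set zs" "a \<noteq> b"
    and 0: "repeats (map even (free_list d (zs @ [a]))) = 0"
      "repeats (map even (free_list d (zs @ [b]))) = 0"
    using two_moves_without_repeats[OF assms(3,4)] .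
  have reply: "forces {1..d} E White 1 (zs @ [a'])"
    if a'b': "goal E White (zs @ [a', b'])" "a' \<in> {1..d} - set zs" "b' \<in> {1..d} - set zs" "a' \<noteq> b'"
      "repeats (map even (free_list d (zs @ [a']))) = 0" for a' b'
  proof -
    have "goal E White (zs @ [a', y])" if y: "y \<in> {1..d} - set (zs @ [a'])" for y
      using even_seq_indifferent[of "zs @ [a']" d y b'] goal_cong[of "zs @ [a', y]" "zs @ [a', b']"]
        y a'b' assms(1,2) by auto
    then show ?thesis
      by (simp add: mover_Suc_0)
  qed
  have "even_seq (zs @ [b, a]) \<noteq> even_seq (zs @ [a, b])"
    using even_seq_swap[of zs a b "[]"] assms(1) ab by auto
  then have "goal E White (zs @ [a, b]) \<or> goal E White (zs @ [b, a])"
    using goal_cases by blast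
  then have "\<exists>x \<in> {1..d} - set zs. forces {1..d} E White 1 (zs @ [x])"
    using reply ab 0 by blast
  then show ?thesis
    by (simp add: numeral_2_eq_2 mover_Suc_0)
qed

text \<open>For even \<open>n\<close> White is to move and can remove one repetition; for odd
  \<open>n\<close> Black is to move from a word without repetitions and can create at most
  one.\<close>

lemma forces_White:
  assumes "n \<ge> 2" "distinct zs" "set zs \<subseteq> {1..d}" "length (free_list d zs) \<ge> n"
    and "repeats (map even (free_list d zs)) \<le> of_bool (even n)"
  shows "forces {1..d} E White n zs"
  using assms
proof (induction n arbitrary: zs rule: nat_induct_at_least)
  case base
  then show ?case
    using forces_White_2 by simp
next
  case (Suc n)
  have IH: "forces {1..d} E White n (zs @ [x])"
    if "x \<in> {1..d} - set zs" "repeats (map even (free_list d (zs @ [x]))) \<le> of_bool (even n)" for x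
    using that Suc.prems repeats_move(3)[of x d zs] by (intro Suc.IH) auto
  show ?case
  proof (cases "even n")
    case True
    then show ?thesis
      using IH repeats_move(2)[of _ d zs] Suc.prems(4) by (simp add: mover_Suc_0)
  next
    case False
    have "repeats (map even (free_list d zs)) \<le> 1" "length (free_list d zs) \<ge> 2"
      using Suc.hyps Suc.prems(3,4) False by simp_all
    then obtain a where "a \<in> {1..d} - set zs" "repeats (map even (free_list d (zs @ [a]))) = 0"
      by (rule two_moves_without_repeats)
    then have "\<exists>x \<in> {1..d} - set zs. forces {1..d} E White n (zs @ [x])"
      by (intro bexI[of _ a] IH) auto
    then show ?thesis
      using False by (simp add: mover_Suc_0)
  qed
qed

text \<open>Whatever is played before, two free elements are left when two turns remain, and a word
  of two letters has at most one repetition.\<close>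

lemma forces_White_full:
  assumes "n \<ge> 2" "distinct zs" "set zs \<subseteq> {1..d}" "length (free_list d zs) = n"
  shows "forces {1..d} E White n zs"
  using assms
proof (induction n arbitrary: zs rule: nat_induct_at_least)
  case base
  then show ?case
    using repeats_le_length[of "map even (free_list d zs)"] by (intro forces_White_2) auto
next
  case (Suc n)
  have "forces {1..d} E White n (zs @ [x])" if "x \<in> {1..d} - set zs" for x
    using that Suc.prems repeats_move(3)[of x d zs] by (intro Suc.IH) auto
  \<comment> \<open>On his own turns White may play any element, but one must exist.\<close>
  moreover have "{1..d} - set zs \<noteq> {}"
    using Suc.prems(3) set_free_list[of d zs] by (metis list.size(3) nat.distinct(1) set_empty)
  ultimately show ?case
    by auto
qed

text \<open>Two consecutive free elements of equal parity have numbers of larger free elements that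
  differ by one, so by \<open>even_seq_move\<close> they yield opposite results.\<close>

lemma forces_Black_1:
  assumes "distinct zs" "set zs \<subseteq> {1..d}" "repeats (map even (free_list d zs)) > 0"
  shows "forces {1..d} E Black 1 zs"
proof -
  obtain us u vs where "map even (free_list d zs) = us @ u # u # vs"
    using repeats_posD[OF assms(3)] .
  then obtain us' a b vs' where fl: "free_list d zs = us' @ a # b # vs'" and ab: "even a = even b"
    by (auto simp: map_eq_append_conv map_eq_Cons_conv)
  have fl': "free_list d zs = (us' @ [a]) @ b # vs'"
    using fl by simp
  have "even_seq (zs @ [a]) \<noteq> even_seq (zs @ [b])"
    using even_seq_move[OF assms(1,2) fl] even_seq_move[OF assms(1,2) fl'] ab by auto
  then have "goal E Black (zs @ [a]) \<or> goal E Black (zs @ [b])"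
    using goal_cases by blast
  then show ?thesis
    using free_list_memD[OF fl] free_list_memD[OF fl'] by (auto simp: mover_Suc_0)
qed

text \<open>For even \<open>n\<close> White is to move and can destroy only one of two repetitions.
  For odd \<open>n\<close> Black is to move: one repetition suffices at the last turn, and earlier
  he restores two.\<close>

lemma forces_Black:
  assumes "n \<ge> 1" "distinct zs" "set zs \<subseteq> {1..d}" "length (free_list d zs) \<ge> n + 2"
    and "repeats (map even (free_list d zs)) \<ge> (if odd n then 1 else 2)"
  shows "forces {1..d} E Black n zs"
  using assms
proof (induction n arbitrary: zs rule: nat_induct_at_least)
  case base
  then show ?case
    by (intro forces_Black_1) auto
next
  case (Suc n)
  have IH: "forces {1..d} E Black n (zs @ [x])"
    if "x \<in> {1..d} - set zs"
      "repeats (map even (free_list d (zs @ [x]))) \<ge> (if odd n then 1 else 2)" for x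
    using that Suc.prems repeats_move(3)[of x d zs] by (intro Suc.IH) auto
  show ?case
  proof (cases "odd n")
    case True
    have "repeats (map even (free_list d (zs @ [x]))) \<ge> 1" if "x \<in> {1..d} - set zs" for x
      using repeats_move(1)[OF that] True Suc.prems(4) by simp
    then show ?thesis
      using IH True by (simp add: mover_Suc_0)
  next
    case False
    \<comment> \<open>Black has at least three turns ahead here, so at least five elements are free,
      as the deletion lemma demands.\<close>
    then have "n \<ge> 2"
      using Suc.hyps by (cases "n = 1") auto
    then have "length (map even (free_list d zs)) \<ge> 5" "repeats (map even (free_list d zs)) \<ge> 1"
      using Suc.prems(3,4) by (auto split: if_splits)
    then obtain us u vs where "map even (free_list d zs) = us @ u # vs" "repeats (us @ vs) \<ge> 2"
      by (rule exists_delete_repeats_ge_2)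
    then obtain us' x vs' where fl: "free_list d zs = us' @ x # vs'"
      and "repeats (map even (us' @ vs')) \<ge> 2"
      by (auto simp: map_eq_append_conv map_eq_Cons_conv)
    then have "repeats (map even (free_list d (zs @ [x]))) \<ge> 2"
      by (simp only: free_list_snoc[OF fl])
    then show ?thesis
      using IH[OF free_list_memD[OF fl]] free_list_memD[OF fl] False by (auto simp: mover_Suc_0)
  qed
qed

text \<open>White's clauses ask for \<open>n \<ge> 2\<close>: if \<open>n = 1\<close> and there is
  no pivot, or only one element is free, then \<open>xs\<close> alone decides the result, possibly
  for Black.\<close>

theorem theorem2p1:
  fixes d m n :: nat and xs :: "nat list" and E :: player
  assumes "n \<ge> 1" and "d \<ge> m + n"
    and "length xs = m" and "distinct xs" and "set xs \<subseteq> {1..d}"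
  shows "(d = m + n \<and> n \<ge> 2 \<longrightarrow> wins {1..d} xs n E White) \<and>
    (d > m + n + 1 \<longrightarrow>
       (pivots {1..d} (set xs) = {} \<and> n \<ge> 2 \<longrightarrow> wins {1..d} xs n E White) \<and>
       (card (pivots {1..d} (set xs)) = 1 \<longrightarrow> wins {1..d} xs n E (first_player n)) \<and>
       (card (pivots {1..d} (set xs)) > 1 \<longrightarrow> wins {1..d} xs n E Black))"
proof -
  let ?k = "repeats (map even (free_list d xs))"
  have len: "length (free_list d xs) = d - m"
    using length_free_list[OF assms(4,5)] assms(3) by simp
  have "card ({1..d} - set xs) = d - m"
    using assms(3-5) by (simp add: card_Diff_subset distinct_card)
  then have wins: "wins {1..d} xs n E P" if "forces {1..d} E P n xs" for P
    using forces_imp_wins[of "{1..d}" n xs E P] that assms(2) by simp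
  have pivots: "card (pivots {1..d} (set xs)) = ?k"
    by (rule card_pivots[OF assms(5)])
  have White: "wins {1..d} xs n E White" if "n \<ge> 2" "?k \<le> of_bool (even n)"
    using that assms(2,4,5) len by (intro wins forces_White) auto
  have Black: "wins {1..d} xs n E Black" if "d > m + n + 1" "?k \<ge> (if odd n then 1 else 2)"
    using that assms(1,4,5) len by (intro wins forces_Black) auto
  show ?thesis
  proof (intro conjI impI; (elim conjE)?)
    assume "d = m + n" "n \<ge> 2"
    then show "wins {1..d} xs n E White"
      using assms(4,5) len by (intro wins forces_White_full) auto
  next
    assume "pivots {1..d} (set xs) = {}" "n \<ge> 2"
    then show "wins {1..d} xs n E White"
      using pivots by (intro White) auto
  next
    assume "d > m + n + 1" "card (pivots {1..d} (set xs)) = 1"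
    \<comment> \<open>One repetition meets the bound of whoever moves first: White for even
      \<open>n\<close>, Black for odd \<open>n\<close>.\<close>
    moreover from assms(1) have "n \<ge> 2" if "even n"
      using that by (cases "n = 1") auto
    ultimately show "wins {1..d} xs n E (first_player n)"
      using White Black pivots by (auto simp: first_player_def mover_def)
  next
    assume "d > m + n + 1" "card (pivots {1..d} (set xs)) > 1"
    then show "wins {1..d} xs n E Black"
      using pivots by (intro Black) auto
  qed
qed

end
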